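(* Let $\nu$ be a non-degenerate probability measure on $\mathbb{R}$ with support bounded from above, with one-sided domain of means $(m_0,m_+)$ and pseudo-variance function $\mathbb{V}$ (as in the context). Suppose that $\mathbb{V}$ extends as a real analytic function to $(m_0,+\infty)$ (still denoted $\mathbb{V}$), and let $$\mathbf{m}_+(\nu)=\inf\Big\{m>m_0:\ m+\frac{\mathbb{V}(m)}{m}=A(\nu)\Big\},\qquad A(\nu)=\sup\operatorname{supp}(\nu).$$ Then for every $m\in(m_0,\mathbf{m}_+(\nu))$ the formula $Q_m(dx)=\frac{\mathbb{V}(m)}{\mathbb{V}(m)+m(m-x)}\nu(dx)$ (for $m\neq0$) defines a probability measure with mean $\int x\,Q_m(dx)=m$; the Cauchy transform satisfies $G_\nu(z)=\frac{m}{\mathbb{V}(m)}$ with $z=m+\frac{\mathbb{V}(m)}{m}$ for all $m\in(m_0,\mathbf{m}_+(\nu))$; and if $\nu$ has finite first moment $m_0=\int x\,\nu(dx)$, then for $m\in(m_0,\mathbf{m}_+(\nu))$ the variance of $Q_m$ is $\int(x-m)^2Q_m(dx)=\frac{(m-m_0)\mathbb{V}(m)}{m}$.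
   Context: Let $B=\max\{0,A(\nu)\}$, $\theta_+=1/B\in(0,\infty]$. For $\theta\in[0,\theta_+)$: $M(\theta)=\int\frac{\nu(dx)}{1-\theta x}$, $P_\theta(dx)=\frac{\nu(dx)}{M(\theta)(1-\theta x)}$, $k(\theta)=\int xP_\theta(dx)=\frac{M(\theta)-1}{\theta M(\theta)}$. The function $k$ is strictly increasing on $(0,\theta_+)$ and maps it onto $(m_0,m_+)$ with $m_0=\lim_{\theta\to0^+}k(\theta)$, $m_+=\lim_{\theta\to\theta_+}k(\theta)$; $\psi$ is its inverse. The pseudo-variance function on $(m_0,m_+)$ is $\mathbb{V}(m)=m\big(\frac1{\psi(m)}-m\big)$ (at $m=0$, $\mathbb{V}(m)/m$ means $1/\psi(0)$, and $Q_0(dx)=\frac{\mathbb{V}'(0)}{\mathbb{V}'(0)-x}\nu(dx)$). $G_\nu(z)=\int\frac{\nu(dx)}{z-x}$ is the Cauchy transform of $\nu$. *)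

theory Defs
  imports "HOL-Probability.Probability"
begin

definition supp :: "real measure \<Rightarrow> real set" where
  "supp \<nu> = {x. \<forall>e>0. 0 < measure \<nu> {x - e <..< x + e}}"

definition A_nu :: "real measure \<Rightarrow> real" where
  "A_nu \<nu> = Sup (supp \<nu>)"

definition B_nu :: "real measure \<Rightarrow> real" where
  "B_nu \<nu> = max 0 (A_nu \<nu>)"

definition theta_plus :: "real measure \<Rightarrow> ereal" where
  "theta_plus \<nu> = (if B_nu \<nu> = 0 then \<infinity> else ereal (1 / B_nu \<nu>))"

definition M_fun :: "real measure \<Rightarrow> real \<Rightarrow> real" where
  "M_fun \<nu> \<theta> = (\<integral>x. 1 / (1 - \<theta> * x) \<partial>\<nu>)"

definition k_fun :: "real measure \<Rightarrow> real \<Rightarrow> real" where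
  "k_fun \<nu> \<theta> = (M_fun \<nu> \<theta> - 1) / (\<theta> * M_fun \<nu> \<theta>)"

definition m_0 :: "real measure \<Rightarrow> ereal" where
  "m_0 \<nu> = Lim (at_right 0) (\<lambda>\<theta>. ereal (k_fun \<nu> \<theta>))"

definition m_plus :: "real measure \<Rightarrow> ereal" where
  "m_plus \<nu> = (if B_nu \<nu> = 0 then Lim at_top (\<lambda>\<theta>. ereal (k_fun \<nu> \<theta>))
               else Lim (at_left (1 / B_nu \<nu>)) (\<lambda>\<theta>. ereal (k_fun \<nu> \<theta>)))"

definition psi :: "real measure \<Rightarrow> real \<Rightarrow> real" where
  "psi \<nu> m = (THE \<theta>. 0 < \<theta> \<and> ereal \<theta> < theta_plus \<nu> \<and> k_fun \<nu> \<theta> = m)"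

definition pseudo_var :: "real measure \<Rightarrow> real \<Rightarrow> real" where
  "pseudo_var \<nu> m = m * (1 / psi \<nu> m - m)"

definition real_analytic_on :: "(real \<Rightarrow> real) \<Rightarrow> real set \<Rightarrow> bool" where
  "real_analytic_on f S \<longleftrightarrow>
     (\<forall>x\<in>S. \<exists>r>0. \<exists>c::nat \<Rightarrow> real. \<forall>y. \<bar>y - x\<bar> < r \<longrightarrow> (\<lambda>n. c n * (y - x) ^ n) sums f y)"

definition Vquot :: "(real \<Rightarrow> real) \<Rightarrow> real \<Rightarrow> real" where
  "Vquot V m = (if m = 0 then deriv V 0 else V m / m)"

text \<open>bold m_plus(nu) = inf{m > m_0 : m + V(m)/m = A(nu)} (inf of empty set = +infinity).\<close>
definition bold_m_plus :: "real measure \<Rightarrow> (real \<Rightarrow> real) \<Rightarrow> ereal" where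
  "bold_m_plus \<nu> V = Inf (ereal ` {m. m_0 \<nu> < ereal m \<and> m + Vquot V m = A_nu \<nu>})"

definition Q_dens :: "(real \<Rightarrow> real) \<Rightarrow> real \<Rightarrow> real \<Rightarrow> real" where
  "Q_dens V m x = (if m \<noteq> 0 then V m / (V m + m * (m - x))
                   else deriv V 0 / (deriv V 0 - x))"

definition Q_meas :: "real measure \<Rightarrow> (real \<Rightarrow> real) \<Rightarrow> real \<Rightarrow> real measure" where
  "Q_meas \<nu> V m = density \<nu> (\<lambda>x. ennreal (Q_dens V m x))"

definition cauchy_transform :: "real measure \<Rightarrow> real \<Rightarrow> real" where
  "cauchy_transform \<nu> z = (\<integral>x. 1 / (z - x) \<partial>\<nu>)"

end

theory Submission
  imports Defs "HOL-Complex_Analysis.Complex_Analysis" "HOL-Real_Asymp.Real_Asymp"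
begin

text \<open>
  Everything is parametrised by \<open>z = 1 / \<theta>\<close>. With \<open>K z = z - 1 / G z\<close>, where \<open>G\<close> is the Cauchy
  transform, one has \<open>k (1 / z) = K z\<close>, and \<open>V m / m = z - m\<close> at \<open>m = K z\<close>. Unlike \<open>\<theta>\<close>, the variable
  \<open>z\<close> may run through all of \<open>(A(\<nu>), \<infinity>)\<close>, also when \<open>A(\<nu>) < 0\<close>, and \<open>K\<close> is still strictly
  decreasing there, with limit \<open>m\<^sub>0\<close> at infinity. Since \<open>K\<close> is analytic, the identity
  \<open>V (K z) = K z * (z - K z)\<close> extends from \<open>z > max 0 A(\<nu>)\<close> to \<open>z > A(\<nu>)\<close> by the identity theorem.
  Letting \<open>z\<close> decrease to \<open>A(\<nu>)\<close> shows that the limit of \<open>K\<close> solves \<open>m + V m / m = A(\<nu>)\<close>, hence every \<open>m\<close>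
  below the infimum of the solutions is \<open>K z\<close> for some \<open>z > A(\<nu>)\<close>. The density of \<open>Q\<^sub>m\<close> is then
  \<open>(z - m) / (z - x)\<close>, and its moments follow from \<open>(z - m) G z = 1\<close>.
\<close>

section \<open>Real analytic functions: derivatives and local holomorphic extensions\<close>

lemma real_analytic_on_has_derivative:
  assumes "real_analytic_on f S" "x \<in> S"
  shows "(f has_real_derivative deriv f x) (at x)"
proof -
  obtain r c where "r > 0" and sums: "\<And>y. \<bar>y - x\<bar> < r \<Longrightarrow> (\<lambda>n. c n * (y - x) ^ n) sums f y"
    using assms unfolding real_analytic_on_def by blast
  have "summable (\<lambda>n. c n * (r / 2) ^ n)"
    using sums[of "x + r / 2"] \<open>r > 0\<close> by (auto intro: sums_summable)
  then have "((\<lambda>h. \<Sum>n. c n * h ^ n) has_field_derivative (\<Sum>n. diffs c n * 0 ^ n)) (at 0)"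
    by (rule termdiffs_strong) (use \<open>r > 0\<close> in auto)
  then have "((\<lambda>h. f (h + x)) has_field_derivative (\<Sum>n. diffs c n * 0 ^ n)) (at 0)"
  proof (rule has_field_derivative_transform_within_open[where S = "{-r<..<r}"])
    fix h assume "h \<in> {-r<..<r}"
    then show "(\<Sum>n. c n * h ^ n) = f (h + x)"
      using sums[of "h + x"] by (auto simp: sums_iff)
  qed (use \<open>r > 0\<close> in auto)
  then have "(f has_real_derivative (\<Sum>n. diffs c n * 0 ^ n)) (at x)"
    using DERIV_shift[of f _ 0 x] by simp
  then show ?thesis
    using DERIV_imp_deriv by metis
qed

text \<open>The same coefficients define a complex power series. Convergence at every real point x +
  t with t < r gives absolute convergence on the whole complex disc. This makes the identity theorem
  for holomorphic functions available for \<open>V\<close>.\<close>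

lemma real_analytic_on_complex_extension:
  assumes "real_analytic_on f S" "x \<in> S"
  obtains r F where "r > 0" "F holomorphic_on ball (complex_of_real x) r"
    "\<And>y. \<bar>y - x\<bar> < r \<Longrightarrow> F (of_real y) = of_real (f y)"
proof -
  obtain r c where "r > 0" and sums: "\<And>y. \<bar>y - x\<bar> < r \<Longrightarrow> (\<lambda>n. c n * (y - x) ^ n) sums f y"
    using assms unfolding real_analytic_on_def by blast
  define F where "F z = (\<Sum>n. of_real (c n) * (z - of_real x) ^ n)" for z :: complex
  have "F holomorphic_on ball (complex_of_real x) r"
  proof (rule power_series_holomorphic[where a = "\<lambda>n. of_real (c n)"])
    fix w assume "w \<in> ball (complex_of_real x) r"
    then have "norm (w - of_real x) < r" by (simp add: dist_norm norm_minus_commute)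
    then obtain t where t: "norm (w - of_real x) < t" "t < r" using dense by blast
    then have "t > 0" using norm_ge_zero le_less_trans by blast
    then have "summable (\<lambda>n. c n * t ^ n)"
      using sums[of "x + t"] t by (auto intro: sums_summable)
    then have "summable (\<lambda>n. norm (c n * norm (w - of_real x) ^ n))"
      by (rule powser_insidea) (use t in auto)
    then have "summable (\<lambda>n. of_real (c n) * (w - of_real x) ^ n)"
      by (intro summable_norm_cancel[of "\<lambda>n. of_real (c n) * (w - of_real x) ^ n"])
        (simp add: norm_mult norm_power abs_mult)
    then show "(\<lambda>n. of_real (c n) * (w - of_real x) ^ n) sums F w"
      unfolding F_def by (rule summable_sums)
  qed
  moreover have "F (of_real y) = of_real (f y)" if "\<bar>y - x\<bar> < r" for y
  proof -
    have "(\<lambda>n. of_real (c n * (y - x) ^ n) :: complex) sums of_real (f y)"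
      using sums[OF that] by (rule sums_of_real)
    then show ?thesis by (simp add: F_def sums_iff)
  qed
  ultimately show thesis using that \<open>r > 0\<close> by blast
qed

section \<open>The support and its supremum\<close>

text \<open>The complement of the support is covered by open intervals of measure zero, and by the
  Lindelof property countably many of the null intervals already cover it.\<close>

lemma AE_in_supp:
  assumes "prob_space \<nu>" "sets \<nu> = sets borel"
  shows "AE x in \<nu>. x \<in> supp \<nu>"
proof -
  interpret prob_space \<nu> by fact
  note [simp, measurable_cong] = assms(2)
  define F where "F = {{x - e <..< x + e} | x e. e > (0::real) \<and> measure \<nu> {x - e <..< x + e} = 0}"
  obtain F' where F': "F' \<subseteq> F" "countable F'" "\<Union>F' = \<Union>F"
    by (rule Lindelof[of F]) (auto simp: F_def)
  have "\<Union>F' \<in> null_sets \<nu>"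
  proof (rule null_sets_UN'[of F' "\<lambda>S. S", simplified])
    fix S assume "S \<in> F'"
    with F'(1) show "S \<in> null_sets \<nu>"
      by (auto simp: F_def null_sets_def emeasure_eq_measure)
  qed fact
  moreover have "- supp \<nu> \<subseteq> \<Union>F"
  proof
    fix x assume "x \<in> - supp \<nu>"
    then obtain e where "e > 0" "measure \<nu> {x - e <..< x + e} = 0"
      by (auto simp: supp_def not_less measure_le_0_iff)
    then have "{x - e <..< x + e} \<in> F" "x \<in> {x - e <..< x + e}"
      by (auto simp: F_def)
    then show "x \<in> \<Union>F" by blast
  qed
  ultimately show ?thesis
    using F'(3) by (intro AE_I'[of "\<Union>F'"]) auto
qed

text \<open>The real supremum \<open>A_nu\<close> is an upper bound of the support only once the
  support is known to be bounded. A support point x > b is impossible, because its neighbourhood of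
  radius x - b lies inside the null set \<open>{b<..}\<close>.\<close>

lemma AE_le_A_nu:
  assumes "prob_space \<nu>" "sets \<nu> = sets borel" "measure \<nu> {b<..} = 0"
  shows "AE x in \<nu>. x \<le> A_nu \<nu>"
proof -
  interpret prob_space \<nu> by fact
  note [simp, measurable_cong] = assms(2)
  have "x \<le> b" if "x \<in> supp \<nu>" for x
  proof (rule ccontr)
    assume "\<not> x \<le> b"
    then have "0 < measure \<nu> {x - (x - b) <..< x + (x - b)}"
      using that unfolding supp_def mem_Collect_eq by (smt (verit))
    also have "\<dots> \<le> measure \<nu> {b<..}"
      by (intro finite_measure_mono) auto
    finally show False using assms(3) by simp
  qed
  then have "bdd_above (supp \<nu>)" by (auto simp: bdd_above_def)
  with AE_in_supp[OF assms(1,2)] show ?thesis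
    by (auto simp: A_nu_def elim!: eventually_mono intro: cSup_upper)
qed

section \<open>The Cauchy transform to the right of the support\<close>

text \<open>For z to the right of the support this is the mean of the law with density proportional
  to 1/(z - x), since the integral of x/(z - x) is z G(z) - 1.\<close>

definition cauchy_mean :: "real measure \<Rightarrow> real \<Rightarrow> real" where
  "cauchy_mean \<nu> z = z - 1 / cauchy_transform \<nu> z"

locale bounded_above_law = prob_space \<nu> for \<nu> :: "real measure" +
  assumes sets_eq_borel [simp, measurable_cong]: "sets \<nu> = sets borel"
    and AE_le: "AE x in \<nu>. x \<le> A_nu \<nu>"
    and nondegenerate: "measure \<nu> {c} < 1"
begin

abbreviation "a \<equiv> A_nu \<nu>"
abbreviation "G \<equiv> cauchy_transform \<nu>"
abbreviation "K \<equiv> cauchy_mean \<nu>"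

lemma integrable_bounded:
  fixes f :: "real \<Rightarrow> 'b::{banach, second_countable_topology}"
  assumes "f \<in> borel_measurable borel" "\<And>x. x \<le> a \<Longrightarrow> norm (f x) \<le> C"
  shows "integrable \<nu> f"
  using assms AE_le by (intro integrable_const_bound[of _ C]) (auto elim!: eventually_mono)

text \<open>A vanishing integral would force f = 0 almost everywhere and so concentrate the law at
  c. Allowing f to vanish at one point is what turns nondegeneracy into strict inequalities.\<close>

lemma AE_pos_integral_pos:
  fixes f :: "real \<Rightarrow> real"
  assumes int: "integrable \<nu> f" and nonneg: "\<And>x. x \<le> a \<Longrightarrow> 0 \<le> f x"
    and pos: "\<And>x. x \<le> a \<Longrightarrow> x \<noteq> c \<Longrightarrow> 0 < f x"
  shows "0 < (\<integral>x. f x \<partial>\<nu>)"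
proof (rule ccontr)
  have ae: "AE x in \<nu>. 0 \<le> f x"
    using AE_le nonneg by (auto elim!: eventually_mono)
  assume "\<not> 0 < (\<integral>x. f x \<partial>\<nu>)"
  with integral_nonneg_AE[OF ae] have "(\<integral>x. f x \<partial>\<nu>) = 0" by simp
  then have "AE x in \<nu>. f x = 0"
    using integral_nonneg_eq_0_iff_AE[OF int ae] by simp
  with AE_le have "AE x in \<nu>. x \<in> {c}"
    by eventually_elim (use pos in force)
  then have "measure \<nu> {c} = 1"
    using AE_in_set_eq_1[of "{c}"] by simp
  then show False using nondegenerate[of c] by simp
qed

lemma kernel_bound:
  assumes "a < z" "x \<le> a"
  shows "\<bar>1 / (z - x)\<bar> \<le> 1 / (z - a)"
  using assms by (auto simp: divide_simps)

lemma integrable_kernel: "a < z \<Longrightarrow> integrable \<nu> (\<lambda>x. 1 / (z - x))"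
  by (rule integrable_bounded[where C = "1 / (z - a)"]) (use kernel_bound in auto)

lemma integrable_kernel2:
  assumes "a < z" "a < w"
  shows "integrable \<nu> (\<lambda>x. 1 / ((z - x) * (w - x)))"
proof (rule integrable_bounded[where C = "1 / ((z - a) * (w - a))"])
  fix x assume "x \<le> a"
  then have "\<bar>1 / (z - x)\<bar> * \<bar>1 / (w - x)\<bar> \<le> 1 / (z - a) * (1 / (w - a))"
    using assms by (intro mult_mono kernel_bound) auto
  then show "norm (1 / ((z - x) * (w - x))) \<le> 1 / ((z - a) * (w - a))"
    by (simp add: abs_mult)
qed simp

lemma G_pos: "a < z \<Longrightarrow> 0 < G z"
  unfolding cauchy_transform_def
  by (rule AE_pos_integral_pos[where c = a, OF integrable_kernel]) auto

lemma K_less: "a < z \<Longrightarrow> K z < z"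
  using G_pos[of z] by (simp add: cauchy_mean_def)

text \<open>The resolvent identity, integrated. It brings differences of \<open>G\<close> into the
  form that is compared with \<open>G z * G w\<close> below.\<close>

lemma G_diff:
  assumes "a < z" "a < w"
  shows "G z - G w = (w - z) * (\<integral>x. 1 / ((z - x) * (w - x)) \<partial>\<nu>)"
proof -
  have "G z - G w = (\<integral>x. 1 / (z - x) - 1 / (w - x) \<partial>\<nu>)"
    unfolding cauchy_transform_def
    by (rule Bochner_Integration.integral_diff[symmetric]) (auto intro: integrable_kernel assms)
  also have "\<dots> = (\<integral>x. (w - z) * (1 / ((z - x) * (w - x))) \<partial>\<nu>)"
  proof (rule integral_cong_AE)
    show "AE x in \<nu>. 1 / (z - x) - 1 / (w - x) = (w - z) * (1 / ((z - x) * (w - x)))"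
      using AE_le by eventually_elim (use assms in \<open>simp add: diff_frac_eq\<close>)
  qed auto
  finally show ?thesis by (simp del: times_divide_eq_right)
qed

text \<open>Chebyshev's correlation inequality for the two increasing kernels, centred at the point
  where the first kernel takes its mean value; that point is \<open>K z\<close>.\<close>

lemma G_mult_less:
  assumes z: "a < z" and w: "z \<le> w"
  shows "G z * G w < (\<integral>x. 1 / ((z - x) * (w - x)) \<partial>\<nu>)"
proof -
  define c where "c = K z"
  have c: "G z = 1 / (z - c)" by (simp add: c_def cauchy_mean_def)
  have "c < z" using K_less[OF z] by (simp add: c_def)
  have "a < w" using z w by simp
  define f where "f x = (1 / (z - x) - G z) * (1 / (w - x) - 1 / (w - c))" for x
  define p where "p = 1 / (w - c)"
  have f_eq: "f x = 1 / ((z - x) * (w - x)) - G z * (1 / (w - x)) - p * (1 / (z - x)) + G z * p" for x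
    by (simp add: f_def p_def[symmetric] algebra_simps)
  have int: "integrable \<nu> f"
    unfolding f_eq using z \<open>a < w\<close>
    by (intro Bochner_Integration.integrable_add Bochner_Integration.integrable_diff
        integrable_kernel2 integrable_mult_right integrable_kernel integrable_const)
  \<comment> \<open>The two terms containing \<open>p\<close> cancel after integration because the
    first factor has mean zero. The second kernel may therefore be centred at its value in c instead
    of at its mean.\<close>
  have "(\<integral>x. f x \<partial>\<nu>) = (\<integral>x. 1 / ((z - x) * (w - x)) \<partial>\<nu>) - G z * G w"
    unfolding f_eq using z \<open>a < w\<close>
    by (simp add: integrable_kernel2 integrable_kernel cauchy_transform_def[symmetric] prob_space
        del: times_divide_eq_right)
  moreover have "0 < (\<integral>x. f x \<partial>\<nu>)"
  proof (rule AE_pos_integral_pos[OF int])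
    \<comment> \<open>Both factors of f change sign at c, which produces the square.\<close>
    have f_sq: "f x = (x - c)\<^sup>2 / ((z - x) * (z - c) * ((w - x) * (w - c)))" if "x \<le> a" for x
      using that z w \<open>c < z\<close> by (simp add: f_def c diff_divide_eq_iff field_simps power2_eq_square)
    show "0 \<le> f x" if "x \<le> a" for x
      using that z w \<open>c < z\<close> by (simp add: f_sq)
    show "0 < f x" if "x \<le> a" "x \<noteq> c" for x
      using that z w \<open>c < z\<close> by (simp add: f_sq)
  qed
  ultimately show ?thesis by simp
qed

text \<open>Dividing G z - G w > (w - z) G z G w by G z G w gives 1/G w - 1/G z > w - z: the
  reciprocal of \<open>G\<close> grows faster than the identity.\<close>

lemma K_strict_antimono:
  assumes "a < z" "z < w"
  shows "K w < K z"
proof -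
  have "G z * G w * (w - z) < G z - G w"
    using G_mult_less[of z w] G_diff[of z w] assms by (simp add: mult.commute)
  then show ?thesis
    using G_pos[of z] G_pos[of w] assms by (simp add: cauchy_mean_def field_simps)
qed

section \<open>Holomorphy of the Cauchy transform\<close>

definition G_complex :: "complex \<Rightarrow> complex" where
  "G_complex z = (\<integral>x. 1 / (z - of_real x) \<partial>\<nu>)"

lemma complex_kernel_bound:
  assumes "a < Re z" "x \<le> a"
  shows "norm (1 / (z - of_real x)) \<le> 1 / (Re z - a)"
proof -
  have "Re z - a \<le> Re (z - of_real x)" using assms by simp
  also have "\<dots> \<le> norm (z - of_real x)" by (rule complex_Re_le_cmod)
  finally show ?thesis using assms by (simp add: norm_divide divide_simps)
qed

lemma integrable_complex_kernel:
  assumes "a < Re z"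
  shows "integrable \<nu> (\<lambda>x. 1 / (z - complex_of_real x))"
  by (rule integrable_bounded[OF _ complex_kernel_bound[OF assms]]) auto

lemma integrable_complex_kernel_power2:
  assumes "a < Re z"
  shows "integrable \<nu> (\<lambda>x. (1 / (z - complex_of_real x))\<^sup>2)"
proof (rule integrable_bounded)
  fix x assume "x \<le> a"
  then show "norm ((1 / (z - complex_of_real x))\<^sup>2) \<le> (1 / (Re z - a))\<^sup>2"
    unfolding norm_power using assms by (intro power_mono complex_kernel_bound) auto
qed auto

lemma G_complex_of_real: "a < z \<Longrightarrow> G_complex (of_real z) = of_real (G z)"
  unfolding G_complex_def cauchy_transform_def
  by (subst integral_complex_of_real[symmetric]) simp

text \<open>The first-order Taylor remainder of the kernel is exactly (w - z)^2 / ((w - x) (z -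
  x)^2), which is bounded uniformly in x \<le> a. Integrating this bound controls the remainder of
  \<open>G_complex\<close>.\<close>

lemma G_complex_difference_quotient:
  assumes z: "a < Re z" and w: "a < Re w"
  shows "norm (G_complex w - G_complex z + (w - z) * (\<integral>x. (1 / (z - of_real x))\<^sup>2 \<partial>\<nu>))
    \<le> (norm (w - z))\<^sup>2 / ((Re w - a) * (Re z - a)\<^sup>2)"
proof -
  let ?k = "\<lambda>z x. 1 / (z - complex_of_real x)"
  have "G_complex w - G_complex z + (w - z) * (\<integral>x. (?k z x)\<^sup>2 \<partial>\<nu>)
      = (\<integral>x. ?k w x - ?k z x + (w - z) * (?k z x)\<^sup>2 \<partial>\<nu>)"
    unfolding G_complex_def
    by (simp add: assms integrable_complex_kernel integrable_complex_kernel_power2 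
        del: power_divide power_one_over)
  also have "norm \<dots> \<le> (\<integral>x. (norm (w - z))\<^sup>2 / ((Re w - a) * (Re z - a)\<^sup>2) \<partial>\<nu>)"
  proof (rule order.trans[OF integral_norm_bound integral_mono_AE])
    show "integrable \<nu> (\<lambda>x. norm (?k w x - ?k z x + (w - z) * (?k z x)\<^sup>2))"
      by (intro integrable_norm Bochner_Integration.integrable_add Bochner_Integration.integrable_diff
          integrable_mult_right integrable_complex_kernel integrable_complex_kernel_power2 assms)
    show "AE x in \<nu>. norm (?k w x - ?k z x + (w - z) * (?k z x)\<^sup>2)
        \<le> (norm (w - z))\<^sup>2 / ((Re w - a) * (Re z - a)\<^sup>2)"
      using AE_le
    proof eventually_elim
      fix x assume x: "x \<le> a"
      have "w \<noteq> of_real x" "z \<noteq> of_real x" using assms x by auto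
      then have "?k w x - ?k z x + (w - z) * (?k z x)\<^sup>2 = (w - z)\<^sup>2 * (?k w x * (?k z x)\<^sup>2)"
        by (simp add: divide_simps) (simp add: power2_eq_square algebra_simps)
      also have "norm \<dots> \<le> (norm (w - z))\<^sup>2 * (1 / (Re w - a) * (1 / (Re z - a))\<^sup>2)"
        unfolding norm_mult norm_power
        using assms x by (intro mult_mono power_mono complex_kernel_bound order_refl) auto
      finally show "norm (?k w x - ?k z x + (w - z) * (?k z x)\<^sup>2)
        \<le> (norm (w - z))\<^sup>2 / ((Re w - a) * (Re z - a)\<^sup>2)"
        by (simp add: power_divide)
    qed
  qed simp
  also have "\<dots> = (norm (w - z))\<^sup>2 / ((Re w - a) * (Re z - a)\<^sup>2)"
    by (simp add: prob_space)
  finally show ?thesis .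
qed

lemma G_complex_has_field_derivative:
  assumes z: "a < Re z"
  shows "(G_complex has_field_derivative - (\<integral>x. (1 / (z - of_real x))\<^sup>2 \<partial>\<nu>)) (at z)"
proof -
  let ?D = "\<integral>x. (1 / (z - complex_of_real x))\<^sup>2 \<partial>\<nu>"
  have Re_ev: "eventually (\<lambda>w. a < Re w) (at z)"
    by (rule order_tendstoD(1)[OF tendsto_Re[OF tendsto_ident_at] z])
  have "((\<lambda>w. (G_complex w - G_complex z) / (w - z) - - ?D) \<longlongrightarrow> 0) (at z)"
  proof (rule Lim_null_comparison)
    show "eventually (\<lambda>w. norm ((G_complex w - G_complex z) / (w - z) - - ?D)
      \<le> norm (w - z) / ((Re w - a) * (Re z - a)\<^sup>2)) (at z)"
      using Re_ev eventually_neq_at_within[of z z UNIV]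
    proof eventually_elim
      fix w assume w: "a < Re w" "w \<noteq> z"
      have "(G_complex w - G_complex z) / (w - z) - - ?D
          = (G_complex w - G_complex z + (w - z) * ?D) / (w - z)"
        using w by (simp add: add_divide_distrib)
      also have "norm \<dots> \<le> (norm (w - z))\<^sup>2 / ((Re w - a) * (Re z - a)\<^sup>2) / norm (w - z)"
        unfolding norm_divide by (intro divide_right_mono G_complex_difference_quotient z w) auto
      also have "\<dots> = norm (w - z) / ((Re w - a) * (Re z - a)\<^sup>2)"
        using w by (simp add: power2_eq_square)
      finally show "norm ((G_complex w - G_complex z) / (w - z) - - ?D)
        \<le> norm (w - z) / ((Re w - a) * (Re z - a)\<^sup>2)" .
    qed
    have "((\<lambda>w. norm (w - z) / ((Re w - a) * (Re z - a)\<^sup>2))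
        \<longlongrightarrow> norm (z - z) / ((Re z - a) * (Re z - a)\<^sup>2)) (at z)"
      using z by (intro tendsto_intros) auto
    then show "((\<lambda>w. norm (w - z) / ((Re w - a) * (Re z - a)\<^sup>2)) \<longlongrightarrow> 0) (at z)"
      by simp
  qed
  then show ?thesis
    by (subst has_field_derivative_iff) (rule LIM_zero_cancel)
qed

lemma G_complex_holomorphic: "G_complex holomorphic_on {z. a < Re z}"
  using G_complex_has_field_derivative
  by (auto simp: holomorphic_on_def field_differentiable_def intro: DERIV_subset[OF _ subset_UNIV])

lemma isCont_G: 
  assumes "a < z"
  shows "isCont G z"
proof -
  have "isCont (\<lambda>w. Re (G_complex (of_real w))) z"
    by (intro isCont_Re isCont_o2[where f = of_real and g = G_complex] isCont_of_real continuous_ident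
        DERIV_isCont[OF G_complex_has_field_derivative]) (use assms in simp)
  moreover have "eventually (\<lambda>w. Re (G_complex (of_real w)) = G w) (nhds z)"
    using eventually_nhds_in_open[of "{a<..}" z] assms
    by (auto elim!: eventually_mono simp: G_complex_of_real)
  ultimately show ?thesis by (simp cong: isCont_cong)
qed

lemma isCont_K: "a < z \<Longrightarrow> isCont K z"
  unfolding cauchy_mean_def[abs_def] using G_pos[of z]
  by (intro continuous_intros isCont_G) auto

section \<open>Monotone limits of \<open>K\<close>\<close>

text \<open>Monotonicity alone gives the limit. The extended reals are used because the infimum may
  be -\<infinity>.\<close>

lemma K_tendsto_INF: "((\<lambda>z. ereal (K z)) \<longlongrightarrow> (INF z\<in>{a<..}. ereal (K z))) at_top"
proof (rule order_tendstoI)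
  fix l assume l: "l < (INF z\<in>{a<..}. ereal (K z))"
  have "l < ereal (K z)" if "a < z" for z
    by (rule less_le_trans[OF l INF_lower]) (use that in simp)
  then show "eventually (\<lambda>z. l < ereal (K z)) at_top"
    using eventually_gt_at_top[of a] by (rule eventually_mono[rotated])
next
  fix u assume "(INF z\<in>{a<..}. ereal (K z)) < u"
  then obtain w where w: "a < w" "ereal (K w) < u" by (auto simp: INF_less_iff)
  show "eventually (\<lambda>z. ereal (K z) < u) at_top"
    using eventually_gt_at_top[of w]
  proof eventually_elim
    fix z assume "w < z"
    with w show "ereal (K z) < u"
      using K_strict_antimono[of w z] by (auto intro: less_trans[of _ "ereal (K w)"])
  qed
qed

text \<open>Applied with b = \<open>B_nu \<nu>\<close> to identify \<open>m_plus\<close>, and with b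
  = a to find the upper end of the full range of \<open>K\<close>.\<close>

lemma K_tendsto_SUP:
  assumes "a \<le> b"
  shows "((\<lambda>z. ereal (K z)) \<longlongrightarrow> (SUP z\<in>{b<..}. ereal (K z))) (at_right b)"
proof (rule order_tendstoI)
  fix u assume u: "(SUP z\<in>{b<..}. ereal (K z)) < u"
  have "ereal (K z) < u" if "b < z" for z
    by (rule le_less_trans[OF SUP_upper u]) (use that in simp)
  then show "eventually (\<lambda>z. ereal (K z) < u) (at_right b)"
    using eventually_at_right_less[of b] by (rule eventually_mono[rotated])
next
  fix l assume "l < (SUP z\<in>{b<..}. ereal (K z))"
  then obtain w where w: "b < w" "l < ereal (K w)" by (auto simp: less_SUP_iff)
  have "eventually (\<lambda>z. z \<in> {b<..<w}) (at_right b)"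
    using w by (intro eventually_at_right_real)
  then show "eventually (\<lambda>z. l < ereal (K z)) (at_right b)"
  proof eventually_elim
    fix z assume "z \<in> {b<..<w}"
    with w assms show "l < ereal (K z)"
      using K_strict_antimono[of z w] by (auto intro: less_trans[of _ "ereal (K w)"])
  qed
qed

section \<open>The change of variable \<theta> = 1/z\<close>

lemma B_nu_props: "0 \<le> B_nu \<nu>" "a \<le> B_nu \<nu>"
  by (auto simp: B_nu_def)

lemma k_fun_inverse:
  assumes "0 < z" "a < z"
  shows "k_fun \<nu> (1 / z) = K z"
proof -
  \<comment> \<open>This holds for every x: at x = z both sides are 0 by the convention for division
    by zero.\<close>
  have "1 / (1 - 1 / z * x) = z * (1 / (z - x))" for x
    using assms by (simp add: field_simps)
  then have "M_fun \<nu> (1 / z) = z * G z"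
    by (simp add: M_fun_def cauchy_transform_def del: times_divide_eq_right)
  then show ?thesis
    using assms G_pos[of z] by (simp add: k_fun_def cauchy_mean_def field_simps)
qed

lemma k_fun_eq:
  assumes "0 < \<theta>" "ereal \<theta> < theta_plus \<nu>"
  shows "k_fun \<nu> \<theta> = K (1 / \<theta>)" "B_nu \<nu> < 1 / \<theta>"
proof -
  have "0 \<le> B_nu \<nu>" by (simp add: B_nu_def)
  then show *: "B_nu \<nu> < 1 / \<theta>"
    using assms by (auto simp: theta_plus_def field_simps split: if_splits)
  then show "k_fun \<nu> \<theta> = K (1 / \<theta>)"
    using assms k_fun_inverse[of "1 / \<theta>"] by (simp add: B_nu_def)
qed

lemma less_theta_plus: "B_nu \<nu> < z \<Longrightarrow> ereal (1 / z) < theta_plus \<nu>"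
  using B_nu_props by (auto simp: theta_plus_def frac_less2)

text \<open>As \<theta> decreases to 0, 1/\<theta> tends to infinity. Only large z matter for the
  limit, so the infimum of the decreasing function \<open>K\<close> can be taken over all z > a,
  even where z \<le> 0.\<close>

lemma m_0_eq_INF: "m_0 \<nu> = (INF z\<in>{a<..}. ereal (K z))"
  unfolding m_0_def
proof (rule tendsto_Lim)
  have "filterlim (\<lambda>\<theta>::real. 1 / \<theta>) at_top (at_right 0)"
    using filterlim_inverse_at_top_right by (simp add: inverse_eq_divide)
  from filterlim_compose[OF K_tendsto_INF this]
  show "((\<lambda>\<theta>. ereal (k_fun \<nu> \<theta>)) \<longlongrightarrow> (INF z\<in>{a<..}. ereal (K z))) (at_right 0)"
  proof (rule Lim_transform_eventually)
    \<comment> \<open>Adding 1 keeps the denominator positive when \<open>B_nu \<nu>\<close> is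
      0.\<close>
    have "eventually (\<lambda>\<theta>. \<theta> \<in> {0<..<1 / (B_nu \<nu> + 1)}) (at_right 0)"
      using B_nu_props by (intro eventually_at_right_real) simp
    then show "eventually (\<lambda>\<theta>. ereal (K (1 / \<theta>)) = ereal (k_fun \<nu> \<theta>)) (at_right 0)"
    proof eventually_elim
      fix \<theta> :: real assume \<theta>: "\<theta> \<in> {0<..<1 / (B_nu \<nu> + 1)}"
      then have "B_nu \<nu> + 1 < 1 / \<theta>" using B_nu_props by (simp add: field_simps)
      then show "ereal (K (1 / \<theta>)) = ereal (k_fun \<nu> \<theta>)"
        using k_fun_inverse[of "1 / \<theta>"] \<theta> B_nu_props by simp
    qed
  qed
qed simp

text \<open>In both cases of the definition 1/\<theta> decreases to \<open>B_nu \<nu>\<close>. The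
  supremum stops at \<open>B_nu \<nu>\<close> and not at a: if a < 0, the means \<open>K z\<close>
  with a < z \<le> 0 are at least \<open>m_plus \<nu>\<close> and are reached only by
  continuation.\<close>

lemma m_plus_eq_SUP: "m_plus \<nu> = (SUP z\<in>{B_nu \<nu><..}. ereal (K z))"
proof (cases "B_nu \<nu> = 0")
  case True
  have lim: "filterlim (\<lambda>\<theta>::real. 1 / \<theta>) (at_right 0) at_top"
    using filterlim_inverse_at_right_top by (simp add: inverse_eq_divide)
  have "((\<lambda>\<theta>. ereal (k_fun \<nu> \<theta>)) \<longlongrightarrow> (SUP z\<in>{B_nu \<nu><..}. ereal (K z))) at_top"
  proof (rule Lim_transform_eventually)
    show "((\<lambda>\<theta>. ereal (K (1 / \<theta>))) \<longlongrightarrow> (SUP z\<in>{B_nu \<nu><..}. ereal (K z))) at_top"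
      using filterlim_compose[OF K_tendsto_SUP[OF B_nu_props(2)], unfolded True, OF lim]
      by (simp add: True)
    show "eventually (\<lambda>\<theta>. ereal (K (1 / \<theta>)) = ereal (k_fun \<nu> \<theta>)) at_top"
      using eventually_gt_at_top[of 0]
      by eventually_elim (simp add: k_fun_eq theta_plus_def True)
  qed
  then show ?thesis
    by (simp add: m_plus_def True tendsto_Lim)
next
  case False
  then have B: "0 < B_nu \<nu>" using B_nu_props by simp
  have in_interval: "eventually (\<lambda>\<theta>. \<theta> \<in> {0<..<1 / B_nu \<nu>}) (at_left (1 / B_nu \<nu>))"
    using B by (intro eventually_at_left_real) simp
  have "filterlim (\<lambda>\<theta>. 1 / \<theta>) (at_right (B_nu \<nu>)) (at_left (1 / B_nu \<nu>))"
  proof (rule filterlim_at_withinI)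
    have "((\<lambda>\<theta>. 1 / \<theta>) \<longlongrightarrow> 1 / (1 / B_nu \<nu>)) (at_left (1 / B_nu \<nu>))"
      using B by (intro tendsto_intros) auto
    then show "((\<lambda>\<theta>. 1 / \<theta>) \<longlongrightarrow> B_nu \<nu>) (at_left (1 / B_nu \<nu>))" by simp
    show "eventually (\<lambda>\<theta>. 1 / \<theta> \<in> {B_nu \<nu><..} - {B_nu \<nu>}) (at_left (1 / B_nu \<nu>))"
      using in_interval by eventually_elim (use B in \<open>auto simp: field_simps\<close>)
  qed
  from filterlim_compose[OF K_tendsto_SUP[OF B_nu_props(2)] this]
  have "((\<lambda>\<theta>. ereal (k_fun \<nu> \<theta>)) \<longlongrightarrow> (SUP z\<in>{B_nu \<nu><..}. ereal (K z))) (at_left (1 / B_nu \<nu>))"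
  proof (rule Lim_transform_eventually)
    show "eventually (\<lambda>\<theta>. ereal (K (1 / \<theta>)) = ereal (k_fun \<nu> \<theta>)) (at_left (1 / B_nu \<nu>))"
      using in_interval by eventually_elim (simp add: k_fun_eq theta_plus_def False)
  qed
  then show ?thesis
    by (simp add: m_plus_def False tendsto_Lim)
qed

lemma m_0_less_K:
  assumes "a < z"
  shows "m_0 \<nu> < ereal (K z)"
proof -
  have "m_0 \<nu> \<le> ereal (K (z + 1))"
    unfolding m_0_eq_INF using assms by (intro INF_lower) auto
  also have "\<dots> < ereal (K z)"
    using K_strict_antimono[of z "z + 1"] assms by simp
  finally show ?thesis .
qed

lemma K_less_m_plus:
  assumes "B_nu \<nu> < z"
  shows "ereal (K z) < m_plus \<nu>"
proof -
  obtain w where w: "B_nu \<nu> < w" "w < z" using dense[OF assms] by blast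
  then have "ereal (K z) < ereal (K w)"
    using K_strict_antimono[of w z] B_nu_props by simp
  also have "\<dots> \<le> m_plus \<nu>"
    unfolding m_plus_eq_SUP using w by (intro SUP_upper) auto
  finally show ?thesis .
qed

lemma K_inject: "a < z \<Longrightarrow> a < w \<Longrightarrow> K z = K w \<Longrightarrow> z = w"
  using K_strict_antimono[of z w] K_strict_antimono[of w z] by (cases z w rule: linorder_cases) auto

text \<open>Injectivity of \<open>K\<close> makes the definite description in \<open>psi\<close>
  meaningful, and the inverse function sends \<open>K z\<close> to 1/z.\<close>

lemma pseudo_var_K:
  assumes "B_nu \<nu> < z"
  shows "pseudo_var \<nu> (K z) = K z * (z - K z)"
proof -
  have "psi \<nu> (K z) = 1 / z"
    unfolding psi_def
  proof (rule the_equality)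
    show "0 < 1 / z \<and> ereal (1 / z) < theta_plus \<nu> \<and> k_fun \<nu> (1 / z) = K z"
      using assms B_nu_props less_theta_plus[OF assms] k_fun_inverse[of z] by simp
    fix \<theta> assume \<theta>: "0 < \<theta> \<and> ereal \<theta> < theta_plus \<nu> \<and> k_fun \<nu> \<theta> = K z"
    then have "K (1 / \<theta>) = K z" "B_nu \<nu> < 1 / \<theta>"
      using k_fun_eq[of \<theta>] by simp_all
    then have "1 / \<theta> = z"
      using assms B_nu_props K_inject[of "1 / \<theta>" z] by simp
    then show "\<theta> = 1 / z" by (metis divide_divide_eq_right div_by_1 mult_1)
  qed
  then show ?thesis by (simp add: pseudo_var_def)
qed

text \<open>\<open>K z\<close> is the quotient of the integrals of x z/(z - x) and of z/(z - x). The
  factor z/(z - x) is bounded by 2 for large z and tends to 1, so dominated convergence applies to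
  both integrals. This identifies \<open>m_0\<close> with the first moment in the variance
  formula.\<close>

lemma K_tendsto_expectation:
  assumes int: "integrable \<nu> (\<lambda>x. x)"
  shows "(K \<longlongrightarrow> (\<integral>x. x \<partial>\<nu>)) at_top"
proof -
  \<comment> \<open>Here x \<le> \<bar>a\<bar> < z/2, so the denominator exceeds z/2.\<close>
  have bound: "\<bar>z / (z - x)\<bar> \<le> 2" if "2 * \<bar>a\<bar> + 1 < z" "x \<le> a" for z x
    using that by (auto simp: field_simps)
  have lim: "((\<lambda>z. z / (z - x)) \<longlongrightarrow> 1) at_top" for x :: real
    by real_asymp
  have lim0: "((\<lambda>z. \<integral>x. z / (z - x) \<partial>\<nu>) \<longlongrightarrow> (\<integral>x. 1 \<partial>\<nu>)) at_top"
  proof (rule integral_dominated_convergence_at_top[where w = "\<lambda>_. 2"])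
    show "eventually (\<lambda>z. AE x in \<nu>. norm (z / (z - x)) \<le> 2) at_top"
      using eventually_gt_at_top[of "2 * \<bar>a\<bar> + 1"]
    proof eventually_elim
      fix z assume "2 * \<bar>a\<bar> + 1 < z"
      with AE_le show "AE x in \<nu>. norm (z / (z - x)) \<le> 2"
        using bound by (auto elim!: eventually_mono)
    qed
  qed (auto simp: lim)
  have lim1: "((\<lambda>z. \<integral>x. x * (z / (z - x)) \<partial>\<nu>) \<longlongrightarrow> (\<integral>x. x \<partial>\<nu>)) at_top"
  proof (rule integral_dominated_convergence_at_top[where w = "\<lambda>x. 2 * \<bar>x\<bar>"])
    show "eventually (\<lambda>z. AE x in \<nu>. norm (x * (z / (z - x))) \<le> 2 * \<bar>x\<bar>) at_top"
      using eventually_gt_at_top[of "2 * \<bar>a\<bar> + 1"]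
    proof eventually_elim
      fix z assume z: "2 * \<bar>a\<bar> + 1 < z"
      from AE_le show "AE x in \<nu>. norm (x * (z / (z - x))) \<le> 2 * \<bar>x\<bar>"
      proof eventually_elim
        fix x assume "x \<le> a"
        then have "\<bar>x\<bar> * \<bar>z / (z - x)\<bar> \<le> \<bar>x\<bar> * 2"
          using bound z by (intro mult_left_mono) auto
        then show "norm (x * (z / (z - x))) \<le> 2 * \<bar>x\<bar>" by (simp add: abs_mult)
      qed
    qed
    show "AE x in \<nu>. ((\<lambda>z. x * (z / (z - x))) \<longlongrightarrow> x) at_top"
      using tendsto_mult[OF tendsto_const lim] by simp
    show "integrable \<nu> (\<lambda>x. 2 * \<bar>x\<bar>)"
      using int by (intro integrable_mult_right integrable_abs)
  qed measurable
  have "((\<lambda>z. (\<integral>x. x * (z / (z - x)) \<partial>\<nu>) / (\<integral>x. z / (z - x) \<partial>\<nu>)) \<longlongrightarrow> (\<integral>x. x \<partial>\<nu>) / (\<integral>x. 1 \<partial>\<nu>)) at_top"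
    by (intro tendsto_divide lim0 lim1) (simp add: prob_space)
  then have "((\<lambda>z. (\<integral>x. x * (z / (z - x)) \<partial>\<nu>) / (\<integral>x. z / (z - x) \<partial>\<nu>)) \<longlongrightarrow> (\<integral>x. x \<partial>\<nu>)) at_top"
    by (simp add: prob_space)
  then show ?thesis
  proof (rule Lim_transform_eventually)
    show "eventually (\<lambda>z. (\<integral>x. x * (z / (z - x)) \<partial>\<nu>) / (\<integral>x. z / (z - x) \<partial>\<nu>) = K z) at_top"
      using eventually_gt_at_top[of a] eventually_gt_at_top[of 0]
    proof eventually_elim
      fix z :: real assume z: "a < z" "0 < z"
      have "(\<integral>x. x * (z / (z - x)) \<partial>\<nu>) = (\<integral>x. z * (z * (1 / (z - x)) - 1) \<partial>\<nu>)"
      proof (rule integral_cong_AE)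
        show "AE x in \<nu>. x * (z / (z - x)) = z * (z * (1 / (z - x)) - 1)"
          using AE_le by eventually_elim (use z in \<open>simp add: field_simps\<close>)
      qed auto
      also have "\<dots> = z * (z * G z - 1)"
        using z by (simp add: integrable_kernel cauchy_transform_def prob_space
            del: times_divide_eq_right)
      finally have "(\<integral>x. x * (z / (z - x)) \<partial>\<nu>) = z * (z * G z - 1)" .
      moreover have "(\<integral>x. z / (z - x) \<partial>\<nu>) = z * G z"
        by (simp add: cauchy_transform_def flip: integral_mult_right_zero)
      ultimately show "(\<integral>x. x * (z / (z - x)) \<partial>\<nu>) / (\<integral>x. z / (z - x) \<partial>\<nu>) = K z"
        using z G_pos[of z] by (simp add: cauchy_mean_def field_simps)
    qed
  qed
qed

lemma m_0_eq_expectation: "integrable \<nu> (\<lambda>x. x) \<Longrightarrow> m_0 \<nu> = ereal (\<integral>x. x \<partial>\<nu>)"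
  unfolding m_0_eq_INF
  by (rule tendsto_unique[OF _ K_tendsto_INF]) (auto intro: K_tendsto_expectation)

section \<open>Analytic continuation of the pseudo-variance identity\<close>

lemma at_right_limit_greater_K:
  assumes "(K \<longlongrightarrow> m) (at_right z\<^sub>0)" "a \<le> z\<^sub>0" "z\<^sub>0 < z"
  shows "K z < m"
proof -
  obtain y where y: "z\<^sub>0 < y" "y < z" using dense assms(3) by blast
  have "K y \<le> m"
  proof (rule tendsto_lowerbound[OF assms(1)])
    show "eventually (\<lambda>w. K y \<le> K w) (at_right z\<^sub>0)"
      using eventually_at_right_real[OF y(1)]
      by eventually_elim (use K_strict_antimono assms(2) in \<open>force intro: less_imp_le\<close>)
  qed simp
  then show ?thesis
    using K_strict_antimono[of y z] y assms(2) by simp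
qed

text \<open>Approaching \<open>m\<close> along values of \<open>K\<close> treats \<open>m = 0\<close>, where \<open>Vquot V m\<close> is a derivative,
  and the boundary value \<open>z\<^sub>0 = a\<close> on the same footing as the regular points.\<close>

lemma Vquot_eq:
  assumes V: "real_analytic_on V {m. m_0 \<nu> < ereal m}"
    and eq: "\<And>z. a < z \<Longrightarrow> V (K z) = K z * (z - K z)"
    and z0: "a \<le> z\<^sub>0" and lim: "(K \<longlongrightarrow> m) (at_right z\<^sub>0)" and m: "m_0 \<nu> < ereal m"
  shows "m + Vquot V m = z\<^sub>0"
proof -
  have deriv: "(V has_real_derivative deriv V m) (at m)"
    using real_analytic_on_has_derivative[OF V] m by simp
  have gt: "eventually (\<lambda>z. z\<^sub>0 < z) (at_right z\<^sub>0)"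
    by (simp add: eventually_at_right_less)
  have ne: "eventually (\<lambda>z. K z \<noteq> m) (at_right z\<^sub>0)"
    using gt by eventually_elim (use at_right_limit_greater_K[OF lim z0] in force)
  have id: "((\<lambda>z. z) \<longlongrightarrow> z\<^sub>0) (at_right z\<^sub>0)" by (rule tendsto_ident_at)
  have "((\<lambda>z. V (K z)) \<longlongrightarrow> V m) (at_right z\<^sub>0)"
    using DERIV_isCont[OF deriv] lim by (rule isCont_tendsto_compose)
  moreover have "((\<lambda>z. V (K z)) \<longlongrightarrow> m * (z\<^sub>0 - m)) (at_right z\<^sub>0)"
  proof (rule Lim_transform_eventually)
    show "((\<lambda>z. K z * (z - K z)) \<longlongrightarrow> m * (z\<^sub>0 - m)) (at_right z\<^sub>0)"
      by (intro tendsto_intros lim id)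
    show "eventually (\<lambda>z. K z * (z - K z) = V (K z)) (at_right z\<^sub>0)"
      using gt by eventually_elim (use eq z0 in simp)
  qed
  ultimately have Vm: "V m = m * (z\<^sub>0 - m)"
    by (rule tendsto_unique[OF trivial_limit_at_right_real])
  show ?thesis
  proof (cases "m = 0")
    case False
    then show ?thesis by (simp add: Vquot_def Vm)
  next
    case True
    \<comment> \<open>For m = 0 the formula for \<open>V m\<close> only says \<open>V 0 = 0\<close>.
      The point \<open>z\<^sub>0\<close> is recovered from the difference quotient of
      \<open>V\<close> at 0, which equals z - \<open>K z\<close> along the values of
      \<open>K\<close>.\<close>
    have "((\<lambda>y. (V y - V m) / (y - m)) \<longlongrightarrow> deriv V m) (at m)"
      using deriv by (simp add: has_field_derivative_iff)
    moreover have "filterlim K (at m) (at_right z\<^sub>0)"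
      using lim ne by (simp add: filterlim_at)
    ultimately have "((\<lambda>z. (V (K z) - V m) / (K z - m)) \<longlongrightarrow> deriv V m) (at_right z\<^sub>0)"
      by (rule filterlim_compose)
    moreover have "((\<lambda>z. (V (K z) - V m) / (K z - m)) \<longlongrightarrow> z\<^sub>0 - m) (at_right z\<^sub>0)"
    proof (rule Lim_transform_eventually)
      show "((\<lambda>z. z - K z) \<longlongrightarrow> z\<^sub>0 - m) (at_right z\<^sub>0)"
        by (intro tendsto_intros lim id)
      show "eventually (\<lambda>z. z - K z = (V (K z) - V m) / (K z - m)) (at_right z\<^sub>0)"
        using gt ne by eventually_elim (use eq z0 Vm True in simp)
    qed
    ultimately have "deriv V m = z\<^sub>0 - m"
      by (rule tendsto_unique[OF trivial_limit_at_right_real])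
    then show ?thesis by (simp add: Vquot_def True)
  qed
qed

text \<open>With \<open>W\<close> extending \<open>V\<close> near \<open>K s\<close> and
  \<open>L\<close> extending \<open>K\<close> near s, the defect of the identity becomes a
  holomorphic function on a disc about s. It vanishes at the real points to the right of s, which
  accumulate at s, hence on the whole disc, including the real points to the left.\<close>

lemma pseudo_var_identity_extend_left:
  assumes V: "real_analytic_on V {m. m_0 \<nu> < ereal m}" and s: "a < s"
    and right: "\<And>z. s < z \<Longrightarrow> V (K z) = K z * (z - K z)"
  obtains d where "d > 0" "\<And>z. s - d < z \<Longrightarrow> V (K z) = K z * (z - K z)"
proof -
  obtain r W where r: "r > 0" and W: "W holomorphic_on ball (complex_of_real (K s)) r"
    and W_eq: "\<And>y. \<bar>y - K s\<bar> < r \<Longrightarrow> W (of_real y) = of_real (V y)"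
    using real_analytic_on_complex_extension[OF V, of "K s"] m_0_less_K[OF s] by auto
  define L where "L z = z - 1 / G_complex z" for z
  have L_of_real: "L (of_real z) = of_real (K z)" if "a < z" for z
    using that by (simp add: L_def G_complex_of_real cauchy_mean_def)
  have cont_G: "isCont G_complex (of_real s)"
    using DERIV_isCont[OF G_complex_has_field_derivative[of "of_real s"]] s by simp
  have G_ne: "G_complex (of_real s) \<noteq> 0"
    using G_complex_of_real[OF s] G_pos[OF s] by simp
  have cont_L: "isCont L (of_real s)"
    unfolding L_def[abs_def] by (intro continuous_intros cont_G G_ne)
  \<comment> \<open>The disc must be small enough for three things: \<open>G_complex\<close> is
    holomorphic there, it has no zero, and \<open>L\<close> maps the disc into the domain of
    \<open>W\<close>.\<close>
  have "eventually (\<lambda>z. a < Re z) (nhds (of_real s))"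
    using s by (intro order_tendstoD(1)[OF tendsto_Re[OF filterlim_ident]]) simp
  moreover have "eventually (\<lambda>z. G_complex z \<noteq> 0) (nhds (of_real s))"
    using cont_G G_ne by (intro tendsto_imp_eventually_ne) (auto simp: isCont_def tendsto_at_iff_tendsto_nhds)
  moreover have "eventually (\<lambda>z. L z \<in> ball (of_real (K s)) r) (nhds (of_real s))"
  proof (rule topological_tendstoD)
    show "(L \<longlongrightarrow> of_real (K s)) (nhds (of_real s))"
      using cont_L[unfolded isCont_def tendsto_at_iff_tendsto_nhds] unfolding L_of_real[OF s] .
  qed (use r in auto)
  ultimately have "eventually (\<lambda>z. a < Re z \<and> G_complex z \<noteq> 0 \<and> L z \<in> ball (of_real (K s)) r)
      (nhds (of_real s))"
    by eventually_elim simp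
  then obtain d where d: "d > 0"
    and ball: "\<And>z. z \<in> ball (of_real s) d \<Longrightarrow> a < Re z \<and> G_complex z \<noteq> 0 \<and> L z \<in> ball (of_real (K s)) r"
    by (auto simp: eventually_nhds_metric dist_commute)
  have G_hol: "G_complex holomorphic_on ball (of_real s) d"
    using ball by (intro holomorphic_on_subset[OF G_complex_holomorphic]) auto
  have L_hol: "L holomorphic_on ball (of_real s) d"
    unfolding L_def[abs_def] using ball by (intro holomorphic_intros G_hol) auto
  have WL_hol: "(\<lambda>z. W (L z)) holomorphic_on ball (of_real s) d"
  proof -
    have "L ` ball (of_real s) d \<subseteq> ball (of_real (K s)) r" using ball by blast
    then show ?thesis using holomorphic_on_compose_gen[OF L_hol W] by (simp add: o_def)
  qed
  define F where "F z = W (L z) - L z * (z - L z)" for z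
  have F_hol: "F holomorphic_on ball (of_real s) d"
    unfolding F_def[abs_def] by (intro holomorphic_intros WL_hol L_hol)
  have F_of_real: "F (of_real z) = of_real (V (K z) - K z * (z - K z))" if "\<bar>z - s\<bar> < d" for z
  proof -
    have *: "complex_of_real z \<in> ball (of_real s) d"
      using that by (simp add: dist_of_real dist_real_def abs_minus_commute)
    have "a < z" using ball[OF *] by simp
    moreover have "\<bar>K z - K s\<bar> < r"
      using ball[OF *] L_of_real[OF \<open>a < z\<close>] by (simp add: dist_of_real dist_real_def abs_minus_commute)
    ultimately show ?thesis by (simp add: F_def L_of_real W_eq)
  qed
  have F_zero: "F w = 0" if "w \<in> ball (of_real s) d" for w
  proof (rule analytic_continuation[OF F_hol])
    let ?U = "complex_of_real ` {s<..<s + d}"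
    show "?U \<subseteq> ball (of_real s) d" by (auto simp: dist_of_real dist_real_def)
    show "complex_of_real s islimpt ?U"
    proof (rule islimptI)
      fix T assume "complex_of_real s \<in> T" "open T"
      then obtain e where e: "e > 0" "ball (complex_of_real s) e \<subseteq> T"
        using openE by blast
      let ?y = "s + min d e / 2"
      have "complex_of_real ?y \<in> ball (of_real s) e"
        using d e(1) unfolding mem_ball dist_of_real dist_real_def by auto
      moreover have "?y \<in> {s<..<s + d}" using d e(1) by auto
      ultimately show "\<exists>y\<in>?U. y \<in> T \<and> y \<noteq> complex_of_real s"
      proof (intro bexI[of _ "complex_of_real ?y"] conjI imageI)
        show "complex_of_real ?y \<noteq> complex_of_real s"
          using d e(1) unfolding of_real_eq_iff by simp
      qed (use e(2) in auto)
    qed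
    show "F z = 0" if "z \<in> ?U" for z
      using that right by (auto simp: F_of_real)
  qed (use d that in auto)
  have "V (K z) = K z * (z - K z)" if "s - d < z" for z
  proof (cases "s < z")
    case False
    then have "\<bar>z - s\<bar> < d" using that by simp
    then have "complex_of_real (V (K z) - K z * (z - K z)) = 0"
      using F_of_real[of z] F_zero[of "of_real z"]
      by (simp add: dist_of_real dist_real_def abs_minus_commute)
    then show ?thesis unfolding of_real_eq_0_iff by simp
  qed (rule right)
  with d that show thesis by blast
qed

text \<open>The points at which the identity fails are bounded by \<open>B_nu \<nu>\<close>. Just
  below their supremum the identity would hold by continuation, a contradiction.\<close>

lemma pseudo_var_identity:
  assumes V: "real_analytic_on V {m. m_0 \<nu> < ereal m}"
    and ext: "\<forall>m. m_0 \<nu> < ereal m \<and> ereal m < m_plus \<nu> \<longrightarrow> V m = pseudo_var \<nu> m"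
    and z: "a < z"
  shows "V (K z) = K z * (z - K z)"
proof (rule ccontr)
  assume ne: "V (K z) \<noteq> K z * (z - K z)"
  \<comment> \<open>Restricting to w \<ge> z keeps the supremum above a, where continuation is
    possible.\<close>
  define T where "T = {w. z \<le> w \<and> V (K w) \<noteq> K w * (w - K w)}"
  have "z \<in> T" using ne by (simp add: T_def)
  have T_le: "w \<le> B_nu \<nu>" if "w \<in> T" for w
  proof (rule ccontr)
    assume "\<not> w \<le> B_nu \<nu>"
    then have w: "B_nu \<nu> < w" by simp
    then have "a < w" using B_nu_props by simp
    have "V (K w) = K w * (w - K w)"
      using ext m_0_less_K[OF \<open>a < w\<close>] K_less_m_plus[OF w] pseudo_var_K[OF w] by simp
    with that show False by (simp add: T_def)
  qed
  then have bdd: "bdd_above T" by (auto simp: bdd_above_def)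
  define s where "s = Sup T"
  have "z \<le> s" unfolding s_def by (rule cSup_upper[OF \<open>z \<in> T\<close> bdd])
  have "V (K w) = K w * (w - K w)" if "s < w" for w
    using cSup_upper[OF _ bdd, of w] that \<open>z \<le> s\<close> by (force simp: s_def T_def)
  with pseudo_var_identity_extend_left[OF V, of s] z \<open>z \<le> s\<close>
  obtain d where d: "d > 0" "\<And>w. s - d < w \<Longrightarrow> V (K w) = K w * (w - K w)"
    by auto
  have "s \<le> s - d"
    unfolding s_def
  proof (rule cSup_least)
    fix w assume "w \<in> T"
    then show "w \<le> Sup T - d"
      using d(2)[of w] by (force simp: T_def s_def)
  qed (use \<open>z \<in> T\<close> in blast)
  with d(1) show False by simp
qed

section \<open>The range of \<open>K\<close> and the bound \<open>bold_m_plus\<close>\<close>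

lemma mean_attained:
  assumes V: "real_analytic_on V {m. m_0 \<nu> < ereal m}"
    and ext: "\<forall>m. m_0 \<nu> < ereal m \<and> ereal m < m_plus \<nu> \<longrightarrow> V m = pseudo_var \<nu> m"
    and m: "m_0 \<nu> < ereal m" "ereal m < bold_m_plus \<nu> V"
  obtains z where "a < z" "K z = m" "m + Vquot V m = z"
proof -
  define S where "S = (SUP z\<in>{a<..}. ereal (K z))"
  \<comment> \<open>The supremum of the means has to be finite before \<open>V\<close> can be
    evaluated there. Up to a + 1 the bound \<open>K z < z\<close> suffices; beyond it, monotonicity
    does.\<close>
  have "S \<le> ereal (a + 1)"
    unfolding S_def
  proof (rule SUP_least)
    fix z assume "z \<in> {a<..}"
    then have "a < z" by simp
    then show "ereal (K z) \<le> ereal (a + 1)"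
      using K_less[of z] K_less[of "a + 1"] K_strict_antimono[of "a + 1" z]
      by (cases "a + 1 < z") auto
  qed
  moreover have "ereal (K (a + 1)) \<le> S" unfolding S_def by (intro SUP_upper) simp
  ultimately obtain m\<^sub>1 where m1: "S = ereal m\<^sub>1" by (cases S) auto
  have "m_0 \<nu> < ereal m\<^sub>1"
    using less_le_trans[OF m_0_less_K[of "a + 1"] \<open>ereal (K (a + 1)) \<le> S\<close>] m1 by simp
  moreover have "(K \<longlongrightarrow> m\<^sub>1) (at_right a)"
    using K_tendsto_SUP[of a] m1 by (simp add: S_def)
  ultimately have "m\<^sub>1 + Vquot V m\<^sub>1 = a"
    by (intro Vquot_eq[OF V pseudo_var_identity[OF V ext]]) auto
  with \<open>m_0 \<nu> < ereal m\<^sub>1\<close> have "bold_m_plus \<nu> V \<le> ereal m\<^sub>1"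
    unfolding bold_m_plus_def by (intro Inf_lower) auto
  \<comment> \<open>Strictness places m below some value of \<open>K\<close>; since
    \<open>m_0\<close> is the infimum, m is also above another, and the intermediate value theorem
    applies.\<close>
  with m(2) have "ereal m < S" unfolding m1 by (rule less_le_trans)
  then obtain u where u: "a < u" "m < K u" by (auto simp: S_def less_SUP_iff)
  obtain w where w: "a < w" "K w < m" using m(1) by (auto simp: m_0_eq_INF INF_less_iff)
  have "u < w"
    using u w K_strict_antimono[of w u] by (cases u w rule: linorder_cases) auto
  then obtain z where z: "u \<le> z" "z \<le> w" "K z = m"
    using IVT2[of K w m u] u w isCont_K by (auto intro: less_imp_le)
  then have "a < z" using u by simp
  moreover have "m + Vquot V m = z"
  proof (rule Vquot_eq[OF V pseudo_var_identity[OF V ext]])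
    show "(K \<longlongrightarrow> m) (at_right z)"
      using isCont_K[OF \<open>a < z\<close>] z(3)
      by (auto simp: isCont_def intro: tendsto_mono[OF at_le])
  qed (use \<open>a < z\<close> m in auto)
  ultimately show thesis using that z(3) by blast
qed

section \<open>The laws \<open>Q_meas\<close> and their moments\<close>

text \<open>Both branches of \<open>Q_dens\<close> reduce to one kernel, so m = 0 needs no separate
  treatment afterwards. The equality holds at every x: at x = z both sides are 0.\<close>

lemma Q_dens_eq:
  assumes "m + Vquot V m = z"
  shows "Q_dens V m = (\<lambda>x. (z - m) * (1 / (z - x)))"
proof (cases "m = 0")
  case False
  have "V m = m * (z - m)" using assms False by (auto simp: Vquot_def)
  then have "V m + m * (m - x) = m * (z - x)" for x by (simp add: algebra_simps)
  then show ?thesis using \<open>V m = _\<close> False by (simp add: Q_dens_def fun_eq_iff)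
qed (use assms in \<open>auto simp: Q_dens_def Vquot_def\<close>)

context
  fixes z m :: real and V :: "real \<Rightarrow> real"
  assumes z: "a < z" and K_z: "K z = m" and Vquot_z: "m + Vquot V m = z"
begin

lemma mean_less: "m < z"
  using K_less[OF z] K_z by simp

lemma G_eq: "G z = 1 / (z - m)"
  using K_z by (auto simp: cauchy_mean_def)

lemma AE_Q_dens_nonneg: "AE x in \<nu>. 0 \<le> Q_dens V m x"
  using AE_le unfolding Q_dens_eq[OF Vquot_z]
  by eventually_elim (use z mean_less in simp)

lemma Q_dens_measurable [measurable]: "Q_dens V m \<in> borel_measurable \<nu>"
  unfolding Q_dens_eq[OF Vquot_z] by measurable

lemma integrable_Q_meas_iff:
  "f \<in> borel_measurable borel \<Longrightarrow>
    integrable (Q_meas \<nu> V m) f \<longleftrightarrow> integrable \<nu> (\<lambda>x. Q_dens V m x * (f x :: real))"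
  unfolding Q_meas_def
  by (subst integrable_density) (auto intro: AE_Q_dens_nonneg)

lemma integral_Q_meas:
  "f \<in> borel_measurable borel \<Longrightarrow>
    (\<integral>x. f x \<partial>Q_meas \<nu> V m) = (\<integral>x. Q_dens V m x * (f x :: real) \<partial>\<nu>)"
  unfolding Q_meas_def
  by (subst integral_density) (auto intro: AE_Q_dens_nonneg)

lemma integrable_Q_dens: "integrable \<nu> (Q_dens V m)"
  unfolding Q_dens_eq[OF Vquot_z] by (intro integrable_mult_right integrable_kernel z)

lemma integral_Q_dens: "(\<integral>x. Q_dens V m x \<partial>\<nu>) = 1"
proof -
  have "(\<integral>x. Q_dens V m x \<partial>\<nu>) = (z - m) * G z"
    unfolding Q_dens_eq[OF Vquot_z] cauchy_transform_def by (rule integral_mult_right_zero)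
  then show ?thesis using G_eq mean_less by simp
qed

lemma prob_space_Q_meas: "prob_space (Q_meas \<nu> V m)"
proof (rule prob_spaceI)
  have "emeasure (Q_meas \<nu> V m) (space (Q_meas \<nu> V m)) = (\<integral>\<^sup>+x. ennreal (Q_dens V m x) \<partial>\<nu>)"
    unfolding Q_meas_def
    by (subst emeasure_density) (auto simp: sets_eq_imp_space_eq[OF sets_eq_borel])
  also have "\<dots> = 1"
    by (simp add: nn_integral_eq_integral integrable_Q_dens AE_Q_dens_nonneg integral_Q_dens)
  finally show "emeasure (Q_meas \<nu> V m) (space (Q_meas \<nu> V m)) = 1" .
qed

text \<open>Since x/(z - x) = z/(z - x) - 1, the first moment reduces to the total mass and equals z
  - (z - m).\<close>

lemma has_bochner_integral_Q_meas_ident: "has_bochner_integral (Q_meas \<nu> V m) (\<lambda>x. x) m"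
proof -
  let ?f = "\<lambda>x. z * Q_dens V m x - (z - m)"
  have AE: "AE x in \<nu>. Q_dens V m x * x = ?f x"
    using AE_le unfolding Q_dens_eq[OF Vquot_z]
    by eventually_elim (use z in \<open>simp add: field_simps\<close>)
  have "integrable \<nu> ?f"
    by (intro Bochner_Integration.integrable_diff integrable_mult_right integrable_Q_dens integrable_const)
  then have "integrable \<nu> (\<lambda>x. Q_dens V m x * x)"
    using AE by (subst integrable_cong_AE[OF _ _ AE]) auto
  moreover have "(\<integral>x. Q_dens V m x * x \<partial>\<nu>) = (\<integral>x. ?f x \<partial>\<nu>)"
    by (rule integral_cong_AE[OF _ _ AE]) auto
  ultimately show ?thesis
    by (simp add: has_bochner_integral_iff integrable_Q_meas_iff integral_Q_meas
        integrable_Q_dens integral_Q_dens prob_space)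
qed

text \<open>Polynomial division of (x - m)^2 by z - x leaves the remainder (z - m)^2 and a quotient
  linear in x. The linear part brings in the first moment of \<open>\<nu>\<close>.\<close>

lemma has_bochner_integral_Q_meas_variance:
  assumes int: "integrable \<nu> (\<lambda>x. x)"
  shows "has_bochner_integral (Q_meas \<nu> V m) (\<lambda>x. (x - m)\<^sup>2) ((m - (\<integral>x. x \<partial>\<nu>)) * (z - m))"
proof -
  let ?f = "\<lambda>x. (z - m)\<^sup>2 * Q_dens V m x - (z - m) * (z - 2 * m) - (z - m) * x"
  have AE: "AE x in \<nu>. Q_dens V m x * (x - m)\<^sup>2 = ?f x"
    using AE_le
  proof eventually_elim
    fix x assume "x \<le> a"
    then have "z - x \<noteq> 0" using z by simp
    then have "(x - m)\<^sup>2 / (z - x) = (z - m)\<^sup>2 / (z - x) - (z - 2 * m) - x"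
      by (simp add: divide_simps) (simp add: power2_eq_square algebra_simps)
    then have "(z - m) * ((x - m)\<^sup>2 / (z - x)) = (z - m) * ((z - m)\<^sup>2 / (z - x) - (z - 2 * m) - x)"
      by simp
    then show "Q_dens V m x * (x - m)\<^sup>2 = ?f x"
      unfolding Q_dens_eq[OF Vquot_z] by (simp add: algebra_simps)
  qed
  have "integrable \<nu> ?f"
    by (intro Bochner_Integration.integrable_diff integrable_mult_right integrable_Q_dens integrable_const int)
  then have "integrable \<nu> (\<lambda>x. Q_dens V m x * (x - m)\<^sup>2)"
    using AE by (subst integrable_cong_AE[OF _ _ AE]) auto
  moreover have "(\<integral>x. Q_dens V m x * (x - m)\<^sup>2 \<partial>\<nu>) = (\<integral>x. ?f x \<partial>\<nu>)"
    by (rule integral_cong_AE[OF _ _ AE]) auto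
  moreover have "(\<integral>x. ?f x \<partial>\<nu>) = (m - (\<integral>x. x \<partial>\<nu>)) * (z - m)"
    by (simp add: integrable_Q_dens integral_Q_dens prob_space int power2_eq_square algebra_simps)
  ultimately show ?thesis
    by (simp add: has_bochner_integral_iff integrable_Q_meas_iff integral_Q_meas)
qed

end

end

theorem theorem3p4:
  fixes \<nu> :: "real measure" and V :: "real \<Rightarrow> real"
  assumes prob: "prob_space \<nu>"
    and borel: "sets \<nu> = sets borel"
    and nondeg: "\<forall>a. measure \<nu> {a} < 1"
    and bdd_above: "\<exists>b. measure \<nu> {b<..} = 0"
    and V_analytic: "real_analytic_on V {m. m_0 \<nu> < ereal m}"
    and V_ext: "\<forall>m. m_0 \<nu> < ereal m \<and> ereal m < m_plus \<nu> \<longrightarrow> V m = pseudo_var \<nu> m"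
  shows "\<forall>m. m_0 \<nu> < ereal m \<and> ereal m < bold_m_plus \<nu> V \<longrightarrow>
            (AE x in \<nu>. 0 \<le> Q_dens V m x)
          \<and> prob_space (Q_meas \<nu> V m)
          \<and> integrable (Q_meas \<nu> V m) (\<lambda>x. x)
          \<and> (\<integral>x. x \<partial>Q_meas \<nu> V m) = m
          \<and> integrable \<nu> (\<lambda>x. 1 / ((m + Vquot V m) - x))
          \<and> cauchy_transform \<nu> (m + Vquot V m) = (if m = 0 then 1 / deriv V 0 else m / V m)
          \<and> (integrable \<nu> (\<lambda>x. x) \<longrightarrow>
               integrable (Q_meas \<nu> V m) (\<lambda>x. (x - m)\<^sup>2)
             \<and> (\<integral>x. (x - m)\<^sup>2 \<partial>Q_meas \<nu> V m) = (m - real_of_ereal (m_0 \<nu>)) * Vquot V m)"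
proof (intro allI impI, elim conjE)
  fix m assume m: "m_0 \<nu> < ereal m" "ereal m < bold_m_plus \<nu> V"
  interpret prob_space \<nu> by (rule prob)
  interpret bounded_above_law \<nu>
  proof
    show "AE x in \<nu>. x \<le> A_nu \<nu>"
      using bdd_above AE_le_A_nu[OF prob borel] by blast
  qed (use borel nondeg in auto)
  obtain z where z: "A_nu \<nu> < z" "cauchy_mean \<nu> z = m" "m + Vquot V m = z"
    by (rule mean_attained[OF V_analytic V_ext m])
  note ident = has_bochner_integral_Q_meas_ident[OF z]
  \<comment> \<open>By the choice of z, z - m is \<open>Vquot V m\<close>; unfolding it yields both
    branches of the claimed value.\<close>
  have "cauchy_transform \<nu> z = 1 / Vquot V m"
    using G_eq[OF z] z(3) by (simp add: algebra_simps)
  then have G_z: "cauchy_transform \<nu> z = (if m = 0 then 1 / deriv V 0 else m / V m)"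
    by (simp add: Vquot_def)
  have variance: "integrable (Q_meas \<nu> V m) (\<lambda>x. (x - m)\<^sup>2)
      \<and> (\<integral>x. (x - m)\<^sup>2 \<partial>Q_meas \<nu> V m) = (m - real_of_ereal (m_0 \<nu>)) * Vquot V m"
    if int: "integrable \<nu> (\<lambda>x. x)"
    using has_bochner_integral_Q_meas_variance[OF z int] m_0_eq_expectation[OF int] z(3)
    by (auto simp: has_bochner_integral_iff)
  show "(AE x in \<nu>. 0 \<le> Q_dens V m x)
          \<and> prob_space (Q_meas \<nu> V m)
          \<and> integrable (Q_meas \<nu> V m) (\<lambda>x. x)
          \<and> (\<integral>x. x \<partial>Q_meas \<nu> V m) = m
          \<and> integrable \<nu> (\<lambda>x. 1 / ((m + Vquot V m) - x))
          \<and> cauchy_transform \<nu> (m + Vquot V m) = (if m = 0 then 1 / deriv V 0 else m / V m)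
          \<and> (integrable \<nu> (\<lambda>x. x) \<longrightarrow>
               integrable (Q_meas \<nu> V m) (\<lambda>x. (x - m)\<^sup>2)
             \<and> (\<integral>x. (x - m)\<^sup>2 \<partial>Q_meas \<nu> V m) = (m - real_of_ereal (m_0 \<nu>)) * Vquot V m)"
    using AE_Q_dens_nonneg[OF z] prob_space_Q_meas[OF z] ident variance G_z
      integrable_kernel[OF z(1)] unfolding z(3)
    by (auto simp: has_bochner_integral_iff)
qed

end
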